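(* Let $G$ be a bridgeless graph with $n$ vertices and $p$ blocks. Then the oriented diameter of $G$ satisfies \[\overrightarrow{\mathrm{diam}}(G) \leq n - \left\lfloor \frac{p}{2} \right\rfloor.\]
   Context: All graphs are finite and simple. A graph is bridgeless if it is connected and has no bridge (an edge whose removal disconnects the graph). A block of $G$ is a maximal connected subgraph of $G$ that has no cut vertex. An orientation of $G$ assigns a direction to each edge; it is strong if the resulting digraph is strongly connected. The diameter of a strong digraph is the maximum over ordered pairs $(u,v)$ of the directed distance from $u$ to $v$. The oriented diameter $\overrightarrow{\mathrm{diam}}(G)$ is the minimum diameter over all strong orientations of $G$ (which exist for bridgeless graphs by Robbins' theorem). *)

theory Defs
  imports "Graph_Theory.Graph_Theory"
begin

text \<open>A finite simple graph is a \<^locale>\<open>graph\<close> of the library: an undirected edge \<open>{u,v}\<close> is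
  the pair of opposite arcs from \<open>u\<close> to \<open>v\<close> and from \<open>v\<close> to \<open>u\<close>.
  Deleting an edge therefore deletes both arcs.\<close>

definition del_edge :: "('a,'b) pre_digraph \<Rightarrow> 'a \<Rightarrow> 'a \<Rightarrow> ('a,'b) pre_digraph" where
  "del_edge G u v = G\<lparr>arcs := {a \<in> arcs G. arc_to_ends G a \<notin> {(u, v), (v, u)}}\<rparr>"

definition bridge :: "('a,'b) pre_digraph \<Rightarrow> 'a \<Rightarrow> 'a \<Rightarrow> bool" where
  "bridge G u v \<longleftrightarrow> u \<rightarrow>\<^bsub>G\<^esub> v \<and> \<not> connected (del_edge G u v)"

definition bridgeless :: "('a,'b) pre_digraph \<Rightarrow> bool" where
  "bridgeless G \<longleftrightarrow> connected G \<and> (\<forall>u v. \<not> bridge G u v)"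

text \<open>Meant for connected graphs. The library's \<^const>\<open>connected\<close> is false for the graph without
  vertices, so the middle condition is what keeps the vertex of the one-vertex graph from being
  a cut vertex.\<close>

definition cut_vertex :: "('a,'b) pre_digraph \<Rightarrow> 'a \<Rightarrow> bool" where
  "cut_vertex G v \<longleftrightarrow> v \<in> verts G \<and> verts (pre_digraph.del_vert G v) \<noteq> {}
     \<and> \<not> connected (pre_digraph.del_vert G v)"

text \<open>Subgraphs of a symmetric digraph in the sense of \<^const>\<open>subgraph\<close> may contain just one arc
  of an edge; \<^const>\<open>symmetric\<close> singles out the undirected subgraphs.\<close>

definition blocks :: "('a,'b) pre_digraph \<Rightarrow> ('a,'b) pre_digraph set" where
  "blocks G = {B. pre_digraph.max_subgraph G
     (\<lambda>H. symmetric H \<and> connected H \<and> (\<forall>v. \<not> cut_vertex H v)) B}"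

definition orientation :: "('a,'b) pre_digraph \<Rightarrow> ('a,'b) pre_digraph \<Rightarrow> bool" where
  "orientation D G \<longleftrightarrow> spanning D G \<and>
     (\<forall>u v. u \<rightarrow>\<^bsub>G\<^esub> v \<longrightarrow> (u \<rightarrow>\<^bsub>D\<^esub> v) \<noteq> (v \<rightarrow>\<^bsub>D\<^esub> u))"

text \<open>With unit weights, the library's \<open>\<mu>\<close> is the least length of a directed walk, i.e. the
  directed distance (\<open>\<infinity>\<close> if there is no walk).\<close>

definition diameter :: "('a,'b) pre_digraph \<Rightarrow> ereal" where
  "diameter D = (SUP (u, v) \<in> verts D \<times> verts D. wf_digraph.\<mu> D (\<lambda>_. 1) u v)"

text \<open>The diameters involved are natural numbers, so the infimum is a minimum whenever a strong
  orientation exists; it is \<open>\<infinity>\<close> otherwise.\<close>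

definition oriented_diameter :: "('a,'b) pre_digraph \<Rightarrow> ereal" where
  "oriented_diameter G = (INF D \<in> {D. orientation D G \<and> strongly_connected D}. diameter D)"

end

theory Submission
  imports Defs
begin

text \<open>
  In every bridgeless graph with at least three vertices, two distinct vertices have distance at
  most \<open>n - 2\<close>, and a shortest path between them extends to a strong orientation. So each
  block that a directed path traverses between two different cut vertices can be oriented to spare
  the path one vertex in a direction of our choice; alternating the choices along a chain
  of blocks spares every path about half a vertex per block. A block that the path does not
  meet spares at least two vertices. Splitting at cut vertices, an induction balances
  the two effects: either a root sits at the end of a chain, where directions alternate, or the graph
  branches and some branch is avoided entirely.
\<close>

section \<open>Strong orientations\<close>

text \<open>A block need not be short in both directions between two of its vertices: in a directed
  triangle, distance 1 from \<open>s\<close> to \<open>x\<close> means distance 2 back. Hence the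
  induction carries two separate one-way bounds for a part and its attaching vertex, and a block
  added at the end of a chain is directed so as to improve whichever of the two is due. The exchange
  rate between sparing and avoiding: a part with \<open>q\<close> blocks has at least
  \<open>2 * q\<close> vertices besides its attaching vertex, whereas it is only asked to spare
  about \<open>q div 2\<close>, so a walk that never enters it is ahead. This surplus pays for a
  weak bound on pairs inside the other part. The constant 5 of that bound in
  \<open>rooted_short\<close> is pinned from two sides: the estimate for walks between two branches
  in \<open>glued_twice\<close> gives no more than \<open>(p - 5) div 2\<close> when all three block
  counts are odd and the middle one is at least 3, and \<open>glued_at_root\<close> can afford no
  less when the other part is a triangle.\<close>

text \<open>Cuts rather than walks are used because arcs are removed and parts are glued below;
  \<open>strongly_connected_iff_strong\<close> is the link to reachability. The empty set and
  singletons qualify, and only arcs inside \<open>W\<close> count, so with a symmetric relation this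
  says that an induced subgraph is connected or empty.\<close>

definition strong :: "'a set \<Rightarrow> 'a rel \<Rightarrow> bool" where
  "strong W M \<longleftrightarrow> (\<forall>S. S \<noteq> {} \<and> S \<subset> W \<longrightarrow> (\<exists>a\<in>S. \<exists>b\<in>W - S. (a, b) \<in> M))"

text \<open>Both pairs point out of \<open>S\<close>, so distinct pairs are distinct undirected
  edges: no cut is empty or consists of a bridge.\<close>

definition two_edge_connected :: "'a rel \<Rightarrow> 'a set \<Rightarrow> bool" where
  "two_edge_connected E W \<longleftrightarrow> (\<forall>S. S \<noteq> {} \<and> S \<subset> W \<longrightarrow>
     (\<exists>a\<in>S. \<exists>b\<in>W - S. \<exists>a'\<in>S. \<exists>b'\<in>W - S. (a, b) \<in> E \<and> (a', b') \<in> E \<and> (a, b) \<noteq> (a', b')))"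

definition orients :: "'a rel \<Rightarrow> 'a set \<Rightarrow> 'a rel \<Rightarrow> bool" where
  "orients E W M \<longleftrightarrow> M \<subseteq> E \<inter> W \<times> W \<and>
     (\<forall>u\<in>W. \<forall>v\<in>W. (u, v) \<in> E \<longrightarrow> ((u, v) \<in> M) \<noteq> ((v, u) \<in> M))"

text \<open>With \<open>n\<close> the number of vertices, a path of the given length avoids at least \<open>k\<close> vertices.
  Counting avoided vertices makes the bounds additive under gluing at a cut vertex.\<close>

definition spare :: "'a rel \<Rightarrow> nat \<Rightarrow> nat \<Rightarrow> 'a \<Rightarrow> 'a \<Rightarrow> bool" where
  "spare M n k u v \<longleftrightarrow> (\<exists>j. (u, v) \<in> M ^^ j \<and> j + k < n)"

lemma strongD:
  assumes "strong W M" "S \<noteq> {}" "S \<subset> W"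
  obtains a b where "a \<in> S" "b \<in> W - S" "(a, b) \<in> M"
  using assms unfolding strong_def by blast

lemma strong_mono:
  assumes "strong W M" "M \<inter> W \<times> W \<subseteq> M'"
  shows "strong W M'"
  unfolding strong_def
proof (intro allI impI)
  fix S assume S: "S \<noteq> {} \<and> S \<subset> W"
  then obtain a b where "a \<in> S" "b \<in> W - S" "(a, b) \<in> M"
    using strongD[OF assms(1), of S] by auto
  then show "\<exists>a\<in>S. \<exists>b\<in>W - S. (a, b) \<in> M'" using S assms(2) by auto
qed

lemma strong_cong:
  assumes "M \<inter> W \<times> W = M' \<inter> W \<times> W"
  shows "strong W M \<longleftrightarrow> strong W M'"
  using strong_mono[of W M M'] strong_mono[of W M' M] assms by auto

lemma two_edge_connectedD:
  assumes "two_edge_connected E W" "S \<noteq> {}" "S \<subset> W"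
  obtains a b a' b' where "a \<in> S" "b \<in> W - S" "a' \<in> S" "b' \<in> W - S"
    "(a, b) \<in> E" "(a', b') \<in> E" "(a, b) \<noteq> (a', b')"
proof -
  have "\<exists>a\<in>S. \<exists>b\<in>W - S. \<exists>a'\<in>S. \<exists>b'\<in>W - S. (a, b) \<in> E \<and> (a', b') \<in> E \<and> (a, b) \<noteq> (a', b')"
    using assms unfolding two_edge_connected_def by simp
  then show thesis using that by (elim bexE conjE) simp
qed

lemma two_edge_connected_strong: "two_edge_connected E W \<Longrightarrow> strong W E"
  unfolding two_edge_connected_def strong_def by meson

section \<open>Walk lengths and avoided vertices\<close>

lemma relpow_mono: "(M :: 'a rel) \<subseteq> M' \<Longrightarrow> M ^^ n \<subseteq> M' ^^ n"
  by (induction n) (auto simp: relcomp_mono)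

lemma spare_mono:
  "spare M n k u v \<Longrightarrow> M \<subseteq> M' \<Longrightarrow> k' + n \<le> k + n' \<Longrightarrow> spare M' n' k' u v"
  unfolding spare_def using relpow_mono[of M M'] by fastforce

text \<open>A walk of length \<open>j\<close> on \<open>n\<close> vertices has slack
  \<open>n - 1 - j\<close>. When two parts share only \<open>x\<close>, \<open>n - 1\<close> is the
  sum of the two values for the parts, so slacks add; the last assumption also admits a larger
  \<open>n\<close> or a smaller \<open>k\<close>.\<close>

lemma spare_concat:
  assumes "spare M\<^sub>1 n\<^sub>1 k\<^sub>1 u x" "spare M\<^sub>2 n\<^sub>2 k\<^sub>2 x v" "M\<^sub>1 \<subseteq> M" "M\<^sub>2 \<subseteq> M" "k + n\<^sub>1 + n\<^sub>2 \<le> k\<^sub>1 + k\<^sub>2 + Suc n"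
  shows "spare M n k u v"
proof -
  obtain i j where i: "(u, x) \<in> M\<^sub>1 ^^ i" "i + k\<^sub>1 < n\<^sub>1" and j: "(x, v) \<in> M\<^sub>2 ^^ j" "j + k\<^sub>2 < n\<^sub>2"
    using assms unfolding spare_def by blast
  have "(u, x) \<in> M ^^ i" "(x, v) \<in> M ^^ j"
    using i j assms relpow_mono by blast+
  then have "(u, v) \<in> M ^^ (i + j)" by (auto simp: relpow_add)
  moreover have "i + j + k < n" using i j assms by linarith
  ultimately show ?thesis unfolding spare_def by blast
qed

text \<open>As long as the ball around \<open>u\<close> is not all of \<open>W\<close>, some arc
  leaves it, and the head of that arc is new in the next ball.\<close>

lemma card_ball_ge:
  assumes "strong W M" "finite W" "u \<in> W"
  defines "R \<equiv> \<lambda>k. {v \<in> W. \<exists>j\<le>k. (u, v) \<in> M ^^ j}"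
  shows "R k = W \<or> k < card (R k)"
proof (induction k)
  case 0
  have "u \<in> R 0" using assms by auto
  moreover have "finite (R 0)" using assms by auto
  ultimately show ?case by (auto simp: card_gt_0_iff)
next
  case (Suc k)
  have sub: "R k \<subseteq> R (Suc k)" and subW: "R (Suc k) \<subseteq> W"
    unfolding R_def by (auto intro: le_SucI)
  have "u \<in> R k" unfolding R_def using assms by (auto intro: exI[of _ 0])
  show ?case
  proof (cases "R k = W")
    case True
    then show ?thesis using sub subW by blast
  next
    case False
    then have "R k \<subset> W" using sub subW by blast
    then obtain a b where ab: "a \<in> R k" "b \<in> W - R k" "(a, b) \<in> M"
      using strongD[OF assms(1)] \<open>u \<in> R k\<close> by (metis empty_iff)
    then obtain j where "j \<le> k" "(u, a) \<in> M ^^ j" unfolding R_def by blast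
    then have "(u, b) \<in> M ^^ Suc j" "Suc j \<le> Suc k" using ab by auto
    then have "b \<in> R (Suc k)" unfolding R_def using ab by blast
    then have "R k \<subset> R (Suc k)" using sub ab by blast
    then have "card (R k) < card (R (Suc k))"
      using assms(2) finite_subset subW psubset_card_mono by metis
    then show ?thesis using Suc False by linarith
  qed
qed

lemma strong_spare:
  assumes "strong W M" "finite W" "u \<in> W" "v \<in> W"
  shows "spare M (card W) 0 u v"
proof -
  define R where "R = {v \<in> W. \<exists>j\<le>card W - 1. (u, v) \<in> M ^^ j}"
  have pos: "card W > 0" using assms by (auto simp: card_gt_0_iff)
  have "R = W \<or> card W - 1 < card R"
    unfolding R_def by (rule card_ball_ge[OF assms(1-3)])
  moreover have "R \<subseteq> W" unfolding R_def by auto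
  ultimately have "R = W" using assms(2) pos
    by (metis One_nat_def Suc_pred card_seteq less_eq_Suc_le)
  then obtain j where "j \<le> card W - 1" "(u, v) \<in> M ^^ j" unfolding R_def using assms by blast
  then show ?thesis unfolding spare_def using pos by (intro exI[of _ j]) auto
qed

section \<open>Distances and strong orientations in two-edge-connected graphs\<close>

locale edge_relation =
  fixes E :: "'a rel"
  assumes sym_E: "(a, b) \<in> E \<Longrightarrow> (b, a) \<in> E"
    and irrefl_E: "(a, a) \<notin> E"
begin

text \<open>On two vertices the cut around one of them is crossed by at most one pair.\<close>

lemma card_two_edge_connected:
  assumes "two_edge_connected E W" "finite W" "card W \<ge> 2"
  shows "card W \<ge> 3"
proof (rule ccontr)
  assume "\<not> card W \<ge> 3"
  then have "card W = 2" using assms by auto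
  then obtain a b where W: "W = {a, b}" "a \<noteq> b" by (auto simp: card_2_iff)
  then have "{a} \<subset> W" by auto
  then show False
    using two_edge_connectedD[OF assms(1), of "{a}"] W by (metis Diff_iff insert_iff empty_iff)
qed

text \<open>Balls around \<open>s\<close> gain at least one vertex per step. If \<open>x\<close>
  were at distance \<open>n - 1\<close>, the ball of radius \<open>n - 2\<close> would be everything
  but \<open>x\<close>, and the previous ball would miss only one more vertex. But the cut around
  \<open>x\<close> has two edges, so two neighbours of \<open>x\<close> must lie outside that
  previous ball.\<close>

lemma spare_undirected:
  assumes bl: "two_edge_connected E W" and fin: "finite W" and "s \<in> W" "x \<in> W" "s \<noteq> x"
  shows "spare (E \<inter> W \<times> W) (card W) 1 s x"
proof (rule ccontr)
  assume neg: "\<not> ?thesis"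
  let ?M = "E \<inter> W \<times> W"
  have "card {s, x} \<le> card W" using assms by (intro card_mono) auto
  then have n3: "card W \<ge> 3" using card_two_edge_connected[OF bl fin] assms by auto
  define R where "R k = {v \<in> W. \<exists>j\<le>k. (s, v) \<in> ?M ^^ j}" for k
  define k where "k = card W - 3"
  have nk: "card W = k + 3" using n3 k_def by auto
  have st: "strong W ?M" using two_edge_connected_strong[OF bl] unfolding strong_def by blast
  have x: "x \<notin> R (Suc k)" using neg nk unfolding R_def spare_def by force
  have sub: "R k \<subseteq> R (Suc k)" unfolding R_def by (auto intro: le_SucI)
  have "R k = W \<or> k < card (R k)" unfolding R_def by (rule card_ball_ge[OF st fin \<open>s \<in> W\<close>])
  then have ck: "k < card (R k)" using x sub \<open>x \<in> W\<close> by auto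
  have "R (Suc k) = W \<or> Suc k < card (R (Suc k))"
    unfolding R_def by (rule card_ball_ge[OF st fin \<open>s \<in> W\<close>])
  then have ck': "Suc k < card (R (Suc k))" using x \<open>x \<in> W\<close> by auto
  have "R (Suc k) \<subseteq> W - {x}" using x unfolding R_def by auto
  moreover have "card (W - {x}) = k + 2" using nk fin \<open>x \<in> W\<close> by auto
  ultimately have eq: "R (Suc k) = W - {x}"
    using ck' fin by (intro card_seteq) auto
  have "W - {x} \<noteq> {}" "W - {x} \<subset> W" using assms by auto
  then obtain a b a' b' where ab: "a \<in> W - {x}" "b \<in> W - (W - {x})" "a' \<in> W - {x}" "b' \<in> W - (W - {x})"
    "(a, b) \<in> E" "(a', b') \<in> E" "(a, b) \<noteq> (a', b')"
    by (rule two_edge_connectedD[OF bl])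
  then have xx: "b = x" "b' = x" "a \<noteq> a'" by auto
  have no: "c \<notin> R k" if "(c, x) \<in> E" "c \<in> W" for c
  proof
    assume "c \<in> R k"
    then obtain j where "j \<le> k" "(s, c) \<in> ?M ^^ j" unfolding R_def by auto
    then have "(s, x) \<in> ?M ^^ Suc j" "Suc j \<le> Suc k" using that \<open>x \<in> W\<close> by auto
    then show False using x \<open>x \<in> W\<close> unfolding R_def by blast
  qed
  \<comment> \<open>The ball of radius \<open>k\<close> has at least \<open>k + 1\<close> vertices;
    with both neighbours this makes \<open>k + 3\<close> inside \<open>W - {x}\<close>, which has
    only \<open>k + 2\<close>.\<close>
  have "R k \<inter> {a, a'} = {}" using no ab xx by auto
  moreover have "finite (R k)" using fin unfolding R_def by auto
  ultimately have "card (R k \<union> {a, a'}) = card (R k) + 2" using xx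
    by (subst card_Un_disjoint) auto
  moreover have "R k \<union> {a, a'} \<subseteq> W - {x}" using sub eq ab by auto
  then have "card (R k \<union> {a, a'}) \<le> k + 2"
    using \<open>card (W - {x}) = k + 2\<close> fin by (metis card_mono finite_Diff)
  ultimately show False using ck by linarith
qed

text \<open>If both removals fail, the two closed sets witnessing this have no arc leaving their
  intersection or their union, so they are complementary and \<open>uv\<close> is a bridge between them.\<close>

lemma remove_one_direction:
  assumes bl: "two_edge_connected E W" and M: "strong W M" "M \<subseteq> E \<inter> W \<times> W"
    and cov: "E \<inter> W \<times> W \<subseteq> M \<union> M\<inverse>"
    and uv: "(u, v) \<in> M" "(v, u) \<in> M"
  shows "strong W (M - {(u, v)}) \<or> strong W (M - {(v, u)})"
proof (rule ccontr)
  assume "\<not> ?thesis"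
  then have "\<not> strong W (M - {(u, v)})" "\<not> strong W (M - {(v, u)})" by auto
  moreover have "\<exists>S. S \<noteq> {} \<and> S \<subset> W \<and> (\<forall>a\<in>S. \<forall>b\<in>W - S. (a, b) \<in> M \<longrightarrow> (a, b) = e)"
    if "\<not> strong W (M - {e})" for e
    using that unfolding strong_def by auto
  ultimately obtain S T where
    S: "S \<noteq> {}" "S \<subset> W" "\<And>a b. a \<in> S \<Longrightarrow> b \<in> W - S \<Longrightarrow> (a, b) \<in> M \<Longrightarrow> (a, b) = (u, v)" and
    T: "T \<noteq> {}" "T \<subset> W" "\<And>a b. a \<in> T \<Longrightarrow> b \<in> W - T \<Longrightarrow> (a, b) \<in> M \<Longrightarrow> (a, b) = (v, u)"
    by metis
  have u: "u \<in> S" "v \<in> W - S" using strongD[OF M(1) S(1,2)] S(3) by (metis prod.inject)+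
  have v: "v \<in> T" "u \<in> W - T" using strongD[OF M(1) T(1,2)] T(3) by (metis prod.inject)+
  have "S \<inter> T = {}"
  proof (rule ccontr)
    assume "S \<inter> T \<noteq> {}"
    then obtain a b where "a \<in> S \<inter> T" "b \<in> W - (S \<inter> T)" "(a, b) \<in> M"
      using S(2) strongD[OF M(1)] by (metis Int_lower1 subset_psubset_trans)
    then show False using S(3)[of a b] T(3)[of a b] u v by auto
  qed
  moreover have "S \<union> T = W"
  proof (rule ccontr)
    assume "S \<union> T \<noteq> W"
    then have "S \<union> T \<subset> W" "S \<union> T \<noteq> {}" using S T by auto
    then obtain a b where "a \<in> S \<union> T" "b \<in> W - (S \<union> T)" "(a, b) \<in> M"
      using strongD[OF M(1)] by metis
    then show False using S(3)[of a b] T(3)[of a b] u v by auto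
  qed
  ultimately have TS: "T = W - S" by auto
  obtain a b a' b' where ab: "a \<in> S" "b \<in> W - S" "a' \<in> S" "b' \<in> W - S"
    "(a, b) \<in> E" "(a', b') \<in> E" "(a, b) \<noteq> (a', b')"
    using two_edge_connectedD[OF bl S(1,2)] .
  have "(c, d) = (u, v)" if "c \<in> S" "d \<in> W - S" "(c, d) \<in> E" for c d
  proof -
    have "(c, d) \<in> M \<or> (d, c) \<in> M" using that cov S by auto
    then show ?thesis using S(3)[of c d] T(3)[of d c] that TS S(2) by auto
  qed
  then show False using ab by metis
qed

text \<open>Starting from a digraph \<open>M\<close> instead of all arcs allows directions to be
  prescribed: an arc of \<open>M\<close> whose reverse is not in \<open>M\<close> survives in
  \<open>M'\<close>.\<close>

lemma exists_strong_suborientation: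
  assumes bl: "two_edge_connected E W" and fin: "finite W"
    and "strong W M" "M \<subseteq> E \<inter> W \<times> W" "E \<inter> W \<times> W \<subseteq> M \<union> M\<inverse>"
  shows "\<exists>M'\<subseteq>M. orients E W M' \<and> strong W M'"
  using assms(3-)
proof (induction "card M" arbitrary: M rule: less_induct)
  case less
  have finM: "finite M" using less.prems(2) fin by (meson finite_Int finite_SigmaI finite_subset)
  show ?case
  proof (cases "\<exists>u v. (u, v) \<in> M \<and> (v, u) \<in> M")
    case True
    then obtain u v where uv: "(u, v) \<in> M" "(v, u) \<in> M" by blast
    then have "u \<noteq> v" using irrefl_E less.prems(2) by auto
    have "\<exists>u v. (u, v) \<in> M \<and> (v, u) \<in> M \<and> u \<noteq> v \<and> strong W (M - {(u, v)})"
      using remove_one_direction[OF bl less.prems uv] uv \<open>u \<noteq> v\<close> by metis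
    then obtain u v where uv: "(u, v) \<in> M" "(v, u) \<in> M" "u \<noteq> v" "strong W (M - {(u, v)})"
      by blast
    have "card (M - {(u, v)}) < card M" using finM uv(1) by (rule card_Diff1_less)
    moreover have "M - {(u, v)} \<subseteq> E \<inter> W \<times> W" using less.prems by auto
    moreover have "E \<inter> W \<times> W \<subseteq> (M - {(u, v)}) \<union> (M - {(u, v)})\<inverse>" using less.prems(3) uv by blast
    ultimately obtain M' where "M' \<subseteq> M - {(u, v)}" "orients E W M'" "strong W M'"
      using less.hyps uv(4) by metis
    then show ?thesis by blast
  next
    case False
    then have "orients E W M" using less.prems unfolding orients_def by blast
    then show ?thesis using less.prems by blast
  qed
qed

lemma exists_strong_orientation:
  assumes "two_edge_connected E W" "finite W"
  shows "\<exists>M. orients E W M \<and> strong W M"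
proof -
  have "strong W (E \<inter> W \<times> W)"
    using two_edge_connected_strong[OF assms(1)] unfolding strong_def by blast
  then show ?thesis using exists_strong_suborientation[OF assms, of "E \<inter> W \<times> W"] by blast
qed

text \<open>A shortest path can be directed consistently without destroying strong connectivity: a cut
  left only through reversed path edges is crossed by the path once, so its only edge is a bridge.\<close>

lemma exists_orientation_spare:
  assumes bl: "two_edge_connected E W" and fin: "finite W" and "s \<in> W" "x \<in> W" "s \<noteq> x"
  shows "\<exists>M. orients E W M \<and> strong W M \<and> spare M (card W) 1 s x"
proof -
  let ?R = "E \<inter> W \<times> W"
  define k where "k = (LEAST j. (s, x) \<in> ?R ^^ j)"
  obtain j where j: "(s, x) \<in> ?R ^^ j" "j + 1 < card W"
    using spare_undirected[OF assms] unfolding spare_def by blast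
  have k: "(s, x) \<in> ?R ^^ k" "k + 1 < card W"
    using j LeastI[of "\<lambda>j. (s, x) \<in> ?R ^^ j" j] Least_le[of "\<lambda>j. (s, x) \<in> ?R ^^ j" j]
    unfolding k_def by auto
  have kmin: "k \<le> i" if "(s, x) \<in> ?R ^^ i" for i
    using that unfolding k_def by (rule Least_le)
  obtain f where f: "f 0 = s" "f k = x" "\<And>i. i < k \<Longrightarrow> (f i, f (Suc i)) \<in> ?R"
    using k(1) unfolding relpow_fun_conv by auto
  have seg: "(f a, f (a + d)) \<in> ?R ^^ d" if "a + d \<le> k" for a d
    using that f(3) unfolding relpow_fun_conv by (intro exI[of _ "\<lambda>i. f (a + i)"]) auto
  \<comment> \<open>A walk of least length repeats no vertex, since cutting out the loop would
    shorten it.\<close>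
  have inj: "a = b" if "f a = f b" "a \<le> k" "b \<le> k" for a b
  proof -
    have "\<not> a < b" if "f a = f b" "a \<le> k" "b \<le> k" for a b
    proof
      assume "a < b"
      have "(s, f a) \<in> ?R ^^ a" using seg[of 0 a] f that by auto
      moreover have "(f b, x) \<in> ?R ^^ (k - b)" using seg[of b "k - b"] f that by auto
      ultimately have "(s, x) \<in> ?R ^^ (a + (k - b))"
        unfolding relpow_add using that(1) by auto
      then have "k \<le> a + (k - b)" by (rule kmin)
      then show False using \<open>a < b\<close> that by linarith
    qed
    from this[of a b] this[of b a] that show ?thesis by auto
  qed
  \<comment> \<open>All edges in both directions, except that the edges of the path keep only their
    forward arc.\<close>
  define M where "M = ?R - {(f (Suc i), f i) | i. i < k}"
  have in_M: "(a, b) \<in> M \<or> (\<exists>i<k. a = f (Suc i) \<and> b = f i)" if "(a, b) \<in> ?R" for a b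
    using that unfolding M_def by auto
  have fM: "(f i, f (Suc i)) \<in> M" if "i < k" for i
  proof (rule ccontr)
    assume "(f i, f (Suc i)) \<notin> M"
    then obtain l where "l < k" "f i = f (Suc l)" "f (Suc i) = f l"
      using in_M f(3)[OF \<open>i < k\<close>] by blast
    then have "i = Suc l" "Suc i = l" using inj that by auto
    then show False by simp
  qed
  have "strong W M"
    unfolding strong_def
  proof (intro allI impI, rule ccontr)
    fix S assume S: "S \<noteq> {} \<and> S \<subset> W" and no: "\<not> (\<exists>a\<in>S. \<exists>b\<in>W - S. (a, b) \<in> M)"
    obtain a b a' b' where ab: "a \<in> S" "b \<in> W - S" "a' \<in> S" "b' \<in> W - S"
      "(a, b) \<in> E" "(a', b') \<in> E" "(a, b) \<noteq> (a', b')"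
      using two_edge_connectedD[OF bl] S by metis
    obtain i where i: "i < k" "a = f (Suc i)" "b = f i" using in_M[of a b] no ab S by blast
    obtain i' where i': "i' < k" "a' = f (Suc i')" "b' = f i'" using in_M[of a' b'] no ab S by blast
    have "i \<noteq> i'" using i i' ab by auto
    \<comment> \<open>Once the path is in \<open>S\<close> it cannot leave, because its forward arcs
      belong to \<open>M\<close>; so it cannot be outside \<open>S\<close> at the later
      index.\<close>
    have contra: False if "i < i'" "i' < k" "f (Suc i) \<in> S" "f i' \<notin> S" for i i'
    proof -
      have "f m \<in> S" if "Suc i \<le> m" "m \<le> i'" for m
        using that
      proof (induction m rule: dec_induct)
        case base
        then show ?case using \<open>f (Suc i) \<in> S\<close> by simp
      next
        case (step m)
        then have "m < k" using \<open>i' < k\<close> by linarith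
        then have "(f m, f (Suc m)) \<in> M" "f (Suc m) \<in> W" using fM f(3) by auto
        then show ?case using step no by (metis DiffI Suc_leD)
      qed
      from this[of i'] that show False by auto
    qed
    show False using contra[of i i'] contra[of i' i] i i' ab \<open>i \<noteq> i'\<close> by (metis DiffD2 nat_neq_iff)
  qed
  moreover have "M \<subseteq> ?R" unfolding M_def by auto
  moreover have "?R \<subseteq> M \<union> M\<inverse>" using in_M fM by auto
  ultimately obtain M' where M': "M' \<subseteq> M" "orients E W M'" "strong W M'"
    using exists_strong_suborientation[OF bl fin] by metis
  have "(f i, f (Suc i)) \<in> M'" if "i < k" for i
  proof -
    \<comment> \<open>The backward arc is gone, so an orientation must contain the forward one and
      the whole path survives.\<close>
    have "(f (Suc i), f i) \<notin> M'" using that M'(1) unfolding M_def by auto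
    then show ?thesis using M'(2) f(3)[OF that] unfolding orients_def by auto
  qed
  then have "(s, x) \<in> M' ^^ k" using f unfolding relpow_fun_conv by auto
  then show ?thesis using M' k unfolding spare_def by auto
qed

end

section \<open>Gluing at cut vertices\<close>

text \<open>The block conditions apart from maximality, stated on vertex sets because blocks are
  induced subgraphs. Deleting \<open>v\<close> may leave the empty set, so singletons qualify, in
  line with \<open>cut_vertex\<close>.\<close>

definition nonseparable :: "'a rel \<Rightarrow> 'a set \<Rightarrow> bool" where
  "nonseparable E U \<longleftrightarrow> U \<noteq> {} \<and> strong U E \<and> (\<forall>v. strong (U - {v}) E)"

definition block_sets :: "'a rel \<Rightarrow> 'a set \<Rightarrow> 'a set set" where
  "block_sets E W = {U. U \<subseteq> W \<and> nonseparable E U \<and>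
     (\<forall>U'. U \<subseteq> U' \<and> U' \<subseteq> W \<and> nonseparable E U' \<longrightarrow> U' = U)}"

text \<open>The components left after deleting a cut vertex \<open>x\<close> are collected into two
  groups, and \<open>x\<close> is returned to both. Neither part is just \<open>{x}\<close>, so both
  are smaller than \<open>W\<close>.\<close>

definition glued :: "'a rel \<Rightarrow> 'a set \<Rightarrow> 'a \<Rightarrow> 'a set \<Rightarrow> 'a set \<Rightarrow> bool" where
  "glued E W x W\<^sub>1 W\<^sub>2 \<longleftrightarrow> W = W\<^sub>1 \<union> W\<^sub>2 \<and> W\<^sub>1 \<inter> W\<^sub>2 = {x} \<and> W\<^sub>1 \<noteq> {x} \<and> W\<^sub>2 \<noteq> {x} \<and>
     (\<forall>a\<in>W\<^sub>1 - {x}. \<forall>b\<in>W\<^sub>2 - {x}. (a, b) \<notin> E)"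

text \<open>Since \<open>spare\<close> is strict, \<open>p div 2 - 1\<close> encodes length at most
  \<open>n - p div 2\<close> once \<open>p\<close> is at least 2; for smaller \<open>p\<close>
  truncated subtraction leaves \<open>n - 1\<close>. The bounds themselves imply strong
  connectivity.\<close>

definition globally_short :: "'a rel \<Rightarrow> 'a set \<Rightarrow> nat \<Rightarrow> bool" where
  "globally_short E W p \<longleftrightarrow> (\<exists>M. orients E W M \<and>
     (\<forall>u\<in>W. \<forall>v\<in>W. spare M (card W) (p div 2 - 1) u v))"

text \<open>The induction hypothesis for a part of the graph attached at \<open>s\<close>. The three bounds are tuned to
  each other: the first two sum to \<open>p - 1\<close>, the number of blocks whose orientation is free to favour
  one direction, and the weak third bound is compensated by the at least two vertices of the
  other part that are avoided.\<close>

definition rooted_short :: "'a rel \<Rightarrow> 'a set \<Rightarrow> 'a \<Rightarrow> nat \<Rightarrow> bool" where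
  "rooted_short E W s p \<longleftrightarrow> (\<exists>M. orients E W M \<and>
     (\<forall>v\<in>W. spare M (card W) ((p - 1) div 2) s v) \<and>
     (\<forall>v\<in>W. spare M (card W) (p div 2) v s) \<and>
     (\<forall>u\<in>W. \<forall>v\<in>W. spare M (card W) ((p - 5) div 2) u v))"

section \<open>Vertex and block counts of glued parts\<close>

lemma glued_card:
  assumes "glued E W x W\<^sub>1 W\<^sub>2" "finite W"
  shows "card W + 1 = card W\<^sub>1 + card W\<^sub>2" "finite W\<^sub>1" "finite W\<^sub>2" "card W\<^sub>1 \<ge> 2" "card W\<^sub>2 \<ge> 2"
    "card W\<^sub>1 < card W" "card W\<^sub>2 < card W"
proof -
  show fin: "finite W\<^sub>1" "finite W\<^sub>2" using assms unfolding glued_def by auto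
  show sum: "card W + 1 = card W\<^sub>1 + card W\<^sub>2"
    using card_Un_Int[OF fin] assms(1) unfolding glued_def by simp
  have two: "card U \<ge> 2" if "x \<in> U" "U \<noteq> {x}" "finite U" for U
  proof -
    obtain y where "y \<in> U" "y \<noteq> x" using \<open>x \<in> U\<close> \<open>U \<noteq> {x}\<close> by blast
    then have "card {x, y} \<le> card U" using that by (intro card_mono) auto
    then show ?thesis using \<open>y \<noteq> x\<close> by auto
  qed
  show "card W\<^sub>1 \<ge> 2" "card W\<^sub>2 \<ge> 2" using two fin assms(1) unfolding glued_def by blast+
  then show "card W\<^sub>1 < card W" "card W\<^sub>2 < card W" using sum by linarith+
qed

text \<open>A set meeting both sides beyond \<open>x\<close> would be disconnected by deleting
  \<open>x\<close>.\<close>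

lemma glued_nonseparable:
  assumes "glued E W x W\<^sub>1 W\<^sub>2" "nonseparable E U" "U \<subseteq> W"
  shows "U \<subseteq> W\<^sub>1 \<or> U \<subseteq> W\<^sub>2"
proof (rule ccontr)
  assume "\<not> ?thesis"
  then obtain a b where ab: "a \<in> U" "a \<notin> W\<^sub>1" "b \<in> U" "b \<notin> W\<^sub>2" by auto
  let ?S = "U \<inter> (W\<^sub>1 - {x})"
  have "b \<in> ?S" "a \<in> U - {x}" "a \<notin> ?S" using ab assms unfolding glued_def by auto
  then have "?S \<noteq> {}" "?S \<subset> U - {x}" by auto
  moreover have "strong (U - {x}) E" using assms unfolding nonseparable_def by auto
  ultimately obtain c d where "c \<in> ?S" "d \<in> (U - {x}) - ?S" "(c, d) \<in> E"
    by (meson strongD)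
  then show False using assms(1,3) unfolding glued_def by blast
qed

lemma finite_block_sets: "finite W \<Longrightarrow> finite (block_sets E W)"
  by (rule finite_subset[of _ "Pow W"]) (auto simp: block_sets_def)

lemma block_sets_subset:
  assumes "U \<in> block_sets E W" "U \<subseteq> V" "V \<subseteq> W"
  shows "U \<in> block_sets E V"
proof -
  have "nonseparable E U" "\<And>U'. U \<subseteq> U' \<Longrightarrow> U' \<subseteq> W \<Longrightarrow> nonseparable E U' \<Longrightarrow> U' = U"
    using assms(1) unfolding block_sets_def by simp_all
  then show ?thesis using assms(2,3) unfolding block_sets_def mem_Collect_eq by (meson subset_trans)
qed

text \<open>Every block of \<open>W\<close> lies in one part and is still maximal there. An upper
  bound is the useful direction because all \<open>spare\<close> bounds weaken as \<open>p\<close>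
  decreases.\<close>

lemma card_block_sets_glued:
  assumes "glued E W x W\<^sub>1 W\<^sub>2" "finite W"
  shows "card (block_sets E W) \<le> card (block_sets E W\<^sub>1) + card (block_sets E W\<^sub>2)"
proof -
  have W: "W = W\<^sub>1 \<union> W\<^sub>2" using assms unfolding glued_def by auto
  have "block_sets E W \<subseteq> block_sets E W\<^sub>1 \<union> block_sets E W\<^sub>2"
  proof
    fix U assume U: "U \<in> block_sets E W"
    then have "U \<subseteq> W" "nonseparable E U" unfolding block_sets_def by auto
    then have "U \<subseteq> W\<^sub>1 \<or> U \<subseteq> W\<^sub>2" using glued_nonseparable[OF assms(1)] by simp
    moreover have "W\<^sub>1 \<subseteq> W" "W\<^sub>2 \<subseteq> W" using W by auto
    ultimately show "U \<in> block_sets E W\<^sub>1 \<union> block_sets E W\<^sub>2"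
      using block_sets_subset[OF U] by auto
  qed
  moreover have "finite (block_sets E W\<^sub>1 \<union> block_sets E W\<^sub>2)"
    using glued_card(2,3)[OF assms] by (simp add: finite_block_sets)
  ultimately have "card (block_sets E W) \<le> card (block_sets E W\<^sub>1 \<union> block_sets E W\<^sub>2)"
    by (simp add: card_mono)
  then show ?thesis
    using card_Un_le[of "block_sets E W\<^sub>1" "block_sets E W\<^sub>2"] by linarith
qed

lemma block_sets_nonempty:
  assumes "finite W" "W \<noteq> {}"
  shows "card (block_sets E W) \<ge> 1"
proof -
  obtain w where "w \<in> W" using assms by auto
  let ?A = "{U. U \<subseteq> W \<and> nonseparable E U}"
  have fin: "finite ?A" using assms by auto
  have "nonseparable E {w}" unfolding nonseparable_def strong_def by auto
  then have "{w} \<in> ?A" using \<open>w \<in> W\<close> by auto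
  from finite_has_maximal2[OF fin this]
  obtain U where U: "U \<in> ?A" "\<forall>U'\<in>?A. U \<subseteq> U' \<longrightarrow> U = U'" by auto
  then have "U \<in> block_sets E W" unfolding block_sets_def by auto
  then have "card (block_sets E W) \<noteq> 0" using finite_block_sets[OF assms(1)] by auto
  then show ?thesis by simp
qed

lemma card_block_sets_nonseparable:
  assumes "nonseparable E W"
  shows "card (block_sets E W) = 1"
proof -
  have "block_sets E W = {W}" using assms unfolding block_sets_def by auto
  then show ?thesis by simp
qed

text \<open>Some deletion of \<open>x\<close> leaves a set \<open>S\<close> without outgoing edges;
  it becomes one side together with \<open>x\<close>, and its complement the other.\<close>

lemma exists_glued:
  assumes "strong W E" "W \<noteq> {}" "\<not> nonseparable E W"
  shows "\<exists>x W\<^sub>1 W\<^sub>2. glued E W x W\<^sub>1 W\<^sub>2"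
proof -
  obtain x where x: "\<not> strong (W - {x}) E" using assms unfolding nonseparable_def by auto
  then have "x \<in> W" using assms by (metis Diff_empty Diff_insert0)
  obtain S where S: "S \<noteq> {}" "S \<subset> W - {x}" "\<forall>a\<in>S. \<forall>b\<in>W - {x} - S. (a, b) \<notin> E"
    using x unfolding strong_def by auto
  have "glued E W x (insert x S) (W - S)"
    unfolding glued_def using S \<open>x \<in> W\<close> by auto
  then show ?thesis by blast
qed

section \<open>Connectivity and orientations of glued graphs\<close>

context edge_relation
begin

lemma glued_commute: "glued E W x W\<^sub>1 W\<^sub>2 \<Longrightarrow> glued E W x W\<^sub>2 W\<^sub>1"
  unfolding glued_def using sym_E by blast

text \<open>When a part is split again, the half containing \<open>x\<close> carries
  \<open>W\<^sub>2\<close> along, so the other half is also a part of \<open>W\<close> itself. This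
  is how pieces of a minimal part are compared with parts of \<open>W\<close>.\<close>

lemma glued_assoc:
  assumes "glued E W x W\<^sub>1 W\<^sub>2" "glued E W\<^sub>1 y H\<^sub>1 H\<^sub>2" "x \<in> H\<^sub>2"
  shows "glued E W y H\<^sub>1 (H\<^sub>2 \<union> W\<^sub>2)"
proof -
  have *: "W = W\<^sub>1 \<union> W\<^sub>2" "W\<^sub>1 \<inter> W\<^sub>2 = {x}" "W\<^sub>2 \<noteq> {x}" "\<And>a b. a \<in> W\<^sub>1 - {x} \<Longrightarrow> b \<in> W\<^sub>2 - {x} \<Longrightarrow> (a, b) \<notin> E"
    "W\<^sub>1 = H\<^sub>1 \<union> H\<^sub>2" "H\<^sub>1 \<inter> H\<^sub>2 = {y}" "H\<^sub>1 \<noteq> {y}" "H\<^sub>2 \<noteq> {y}" "\<And>a b. a \<in> H\<^sub>1 - {y} \<Longrightarrow> b \<in> H\<^sub>2 - {y} \<Longrightarrow> (a, b) \<notin> E"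
    using assms unfolding glued_def by auto
  have "(a, b) \<notin> E" if "a \<in> H\<^sub>1 - {y}" "b \<in> H\<^sub>2 \<union> W\<^sub>2 - {y}" for a b
  proof (cases "b \<in> H\<^sub>2")
    case True
    then show ?thesis using *(9) that by blast
  next
    case False
    then have "a \<in> W\<^sub>1 - {x}" "b \<in> W\<^sub>2 - {x}" using that * assms(3) by blast+
    then show ?thesis using *(4) by blast
  qed
  moreover have "H\<^sub>1 \<inter> W\<^sub>2 \<subseteq> H\<^sub>1 \<inter> H\<^sub>2" using *(2,5) assms(3) by auto
  then have "H\<^sub>1 \<inter> (H\<^sub>2 \<union> W\<^sub>2) = {y}" using *(6) by auto
  moreover have "H\<^sub>2 \<union> W\<^sub>2 \<noteq> {y}" using *(6,8) by auto
  moreover have "W = H\<^sub>1 \<union> (H\<^sub>2 \<union> W\<^sub>2)" using *(1,5) by auto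
  ultimately show ?thesis unfolding glued_def using *(7) by simp
qed

lemma glued_two_edge_connected:
  assumes gl: "glued E W x W\<^sub>1 W\<^sub>2" and bl: "two_edge_connected E W"
  shows "two_edge_connected E W\<^sub>1"
proof -
  have *: "W = W\<^sub>1 \<union> W\<^sub>2" "W\<^sub>1 \<inter> W\<^sub>2 = {x}" "\<And>a b. a \<in> W\<^sub>1 - {x} \<Longrightarrow> b \<in> W\<^sub>2 - {x} \<Longrightarrow> (a, b) \<notin> E"
    using gl unfolding glued_def by auto
  have in1: "d \<in> W\<^sub>1" if "(c, d) \<in> E" "c \<in> W\<^sub>1 - {x}" "d \<in> W" for c d
    using that * by blast
  let ?two = "\<lambda>S. \<exists>a\<in>S. \<exists>b\<in>W\<^sub>1 - S. \<exists>a'\<in>S. \<exists>b'\<in>W\<^sub>1 - S. (a, b) \<in> E \<and> (a', b') \<in> E \<and> (a, b) \<noteq> (a', b')"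
  \<comment> \<open>A set avoiding \<open>x\<close> has no edge into \<open>W\<^sub>2 - {x}\<close>,
    so both edges leaving it in \<open>W\<close> stay in \<open>W\<^sub>1\<close>. A set containing
    \<open>x\<close> is handled below by its complement with the edges reversed.\<close>
  have off: "?two S" if S: "S \<noteq> {}" "S \<subset> W\<^sub>1" "x \<notin> S" for S
  proof -
    have "S \<subset> W" using S * by auto
    obtain a b a' b' where ab: "a \<in> S" "b \<in> W - S" "a' \<in> S" "b' \<in> W - S"
      "(a, b) \<in> E" "(a', b') \<in> E" "(a, b) \<noteq> (a', b')"
      by (rule two_edge_connectedD[OF bl S(1) \<open>S \<subset> W\<close>])
    then have "b \<in> W\<^sub>1 - S" "b' \<in> W\<^sub>1 - S" using in1[of a b] in1[of a' b'] S by auto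
    with ab show ?thesis by blast
  qed
  show ?thesis
    unfolding two_edge_connected_def
  proof (intro allI impI)
    fix S assume S: "S \<noteq> {} \<and> S \<subset> W\<^sub>1"
    show "?two S"
    proof (cases "x \<in> S")
      case False
      then show ?thesis using off S by auto
    next
      case True
      have "?two (W\<^sub>1 - S)" using S True by (intro off) auto
      then obtain a b a' b' where ab: "a \<in> W\<^sub>1 - S" "b \<in> W\<^sub>1 - (W\<^sub>1 - S)" "a' \<in> W\<^sub>1 - S" "b' \<in> W\<^sub>1 - (W\<^sub>1 - S)"
        "(a, b) \<in> E" "(a', b') \<in> E" "(a, b) \<noteq> (a', b')"
        by (elim bexE conjE)
      have "(b, a) \<in> E" "(b', a') \<in> E" "(b, a) \<noteq> (b', a')" "b \<in> S" "b' \<in> S"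
        using ab sym_E by auto
      then show ?thesis using ab(1,3) by blast
    qed
  qed
qed

lemma glued_orients:
  assumes gl: "glued E W x W\<^sub>1 W\<^sub>2" and "orients E W\<^sub>1 M\<^sub>1" "orients E W\<^sub>2 M\<^sub>2"
  shows "orients E W (M\<^sub>1 \<union> M\<^sub>2)"
proof -
  have *: "W = W\<^sub>1 \<union> W\<^sub>2" "W\<^sub>1 \<inter> W\<^sub>2 = {x}" "\<And>a b. a \<in> W\<^sub>1 - {x} \<Longrightarrow> b \<in> W\<^sub>2 - {x} \<Longrightarrow> (a, b) \<notin> E"
    using gl unfolding glued_def by auto
  have M: "M\<^sub>1 \<subseteq> E \<inter> W\<^sub>1 \<times> W\<^sub>1" "M\<^sub>2 \<subseteq> E \<inter> W\<^sub>2 \<times> W\<^sub>2" using assms unfolding orients_def by auto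
  have both: "\<not> (u \<in> W\<^sub>1 \<and> v \<in> W\<^sub>1 \<and> u \<in> W\<^sub>2 \<and> v \<in> W\<^sub>2)" if "(u, v) \<in> E" for u v
  proof
    assume "u \<in> W\<^sub>1 \<and> v \<in> W\<^sub>1 \<and> u \<in> W\<^sub>2 \<and> v \<in> W\<^sub>2"
    then have "u \<in> W\<^sub>1 \<inter> W\<^sub>2" "v \<in> W\<^sub>1 \<inter> W\<^sub>2" by auto
    then have "u = x" "v = x" unfolding *(2) by auto
    then show False using that irrefl_E by simp
  qed
  have "((u, v) \<in> M\<^sub>1 \<union> M\<^sub>2) \<noteq> ((v, u) \<in> M\<^sub>1 \<union> M\<^sub>2)" if uv: "u \<in> W" "v \<in> W" "(u, v) \<in> E" for u v
  proof -
    consider "u \<in> W\<^sub>1" "v \<in> W\<^sub>1" | "u \<in> W\<^sub>2" "v \<in> W\<^sub>2"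
      using uv *(1,2) *(3)[of u v] *(3)[of v u] sym_E[OF uv(3)] by auto
    then show ?thesis
    proof cases
      case 1
      then have "(u, v) \<notin> M\<^sub>2" "(v, u) \<notin> M\<^sub>2" using both uv M by blast+
      then show ?thesis using 1 uv assms(2) unfolding orients_def by auto
    next
      case 2
      then have "(u, v) \<notin> M\<^sub>1" "(v, u) \<notin> M\<^sub>1" using both uv M by blast+
      then show ?thesis using 2 uv assms(3) unfolding orients_def by auto
    qed
  qed
  then show ?thesis using M * unfolding orients_def by blast
qed

text \<open>Under gluing \<open>n - 1\<close> is additive and \<open>2 * p\<close> at most additive;
  the base case is one block with at least three vertices.\<close>

lemma card_block_sets_less:
  assumes "two_edge_connected E W" "finite W" "card W \<ge> 2"
  shows "2 * card (block_sets E W) < card W"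
  using assms
proof (induction "card W" arbitrary: W rule: less_induct)
  case less
  show ?case
  proof (cases "nonseparable E W")
    case True
    then show ?thesis
      using card_block_sets_nonseparable[OF True] card_two_edge_connected[OF less.prems] by simp
  next
    case False
    then obtain x W\<^sub>1 W\<^sub>2 where gl: "glued E W x W\<^sub>1 W\<^sub>2"
      using exists_glued two_edge_connected_strong less.prems by (metis card.empty not_numeral_le_zero)
    note c = glued_card[OF gl less.prems(2)]
    have "2 * card (block_sets E W\<^sub>1) < card W\<^sub>1" "2 * card (block_sets E W\<^sub>2) < card W\<^sub>2"
      using less.hyps c glued_two_edge_connected gl glued_commute less.prems(1) by blast+
    then show ?thesis using c card_block_sets_glued[OF gl less.prems(2)] by linarith
  qed
qed

section \<open>Combining orientations across cut vertices\<close>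

text \<open>Between the parts, walks go through \<open>x\<close> and lose at most one to rounding,
  which the \<open>- 1\<close> in \<open>globally_short\<close> absorbs. Inside one part, the other
  is avoided entirely. The tight case is a triangle as other part: for \<open>p\<^sub>1\<close> at
  least 5, its two avoided vertices raise \<open>(p\<^sub>1 - 5) div 2\<close> to exactly
  \<open>(p\<^sub>1 + 1) div 2 - 1\<close>.\<close>

lemma glued_at_root:
  assumes gl: "glued E W x W\<^sub>1 W\<^sub>2" and fin: "finite W"
    and "rooted_short E W\<^sub>1 x p\<^sub>1" "rooted_short E W\<^sub>2 x p\<^sub>2"
    and p: "1 \<le> p\<^sub>1" "1 \<le> p\<^sub>2" "2 * p\<^sub>1 < card W\<^sub>1" "2 * p\<^sub>2 < card W\<^sub>2" "p \<le> p\<^sub>1 + p\<^sub>2"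
  shows "globally_short E W p" "rooted_short E W x p"
proof -
  obtain M\<^sub>1 where M1: "orients E W\<^sub>1 M\<^sub>1"
    and from1: "\<And>v. v \<in> W\<^sub>1 \<Longrightarrow> spare M\<^sub>1 (card W\<^sub>1) ((p\<^sub>1 - 1) div 2) x v"
    and to1: "\<And>v. v \<in> W\<^sub>1 \<Longrightarrow> spare M\<^sub>1 (card W\<^sub>1) (p\<^sub>1 div 2) v x"
    and all1: "\<And>u v. u \<in> W\<^sub>1 \<Longrightarrow> v \<in> W\<^sub>1 \<Longrightarrow> spare M\<^sub>1 (card W\<^sub>1) ((p\<^sub>1 - 5) div 2) u v"
    using assms(3) unfolding rooted_short_def by auto
  obtain M\<^sub>2 where M2: "orients E W\<^sub>2 M\<^sub>2"
    and from2: "\<And>v. v \<in> W\<^sub>2 \<Longrightarrow> spare M\<^sub>2 (card W\<^sub>2) ((p\<^sub>2 - 1) div 2) x v"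
    and to2: "\<And>v. v \<in> W\<^sub>2 \<Longrightarrow> spare M\<^sub>2 (card W\<^sub>2) (p\<^sub>2 div 2) v x"
    and all2: "\<And>u v. u \<in> W\<^sub>2 \<Longrightarrow> v \<in> W\<^sub>2 \<Longrightarrow> spare M\<^sub>2 (card W\<^sub>2) ((p\<^sub>2 - 5) div 2) u v"
    using assms(4) unfolding rooted_short_def by auto
  let ?M = "M\<^sub>1 \<union> M\<^sub>2"
  note c = glued_card[OF gl fin]
  have W: "v \<in> W\<^sub>1 \<or> v \<in> W\<^sub>2" if "v \<in> W" for v using that gl unfolding glued_def by auto
  have M: "orients E W ?M" using gl M1 M2 by (rule glued_orients)
  have all: "spare ?M (card W) (p div 2 - 1) u v" if uv: "u \<in> W" "v \<in> W" for u v
  proof -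
    consider "u \<in> W\<^sub>1" "v \<in> W\<^sub>1" | "u \<in> W\<^sub>2" "v \<in> W\<^sub>2" | "u \<in> W\<^sub>1" "v \<in> W\<^sub>2" | "u \<in> W\<^sub>2" "v \<in> W\<^sub>1"
      using W uv by blast
    then show ?thesis
    proof cases
      case 1
      show ?thesis by (rule spare_mono[OF all1[OF 1]]) (use c p in auto)
    next
      case 2
      show ?thesis by (rule spare_mono[OF all2[OF 2]]) (use c p in auto)
    next
      case 3
      show ?thesis by (rule spare_concat[OF to1[OF 3(1)] from2[OF 3(2)]]) (use c p in auto)
    next
      case 4
      show ?thesis by (rule spare_concat[OF to2[OF 4(1)] from1[OF 4(2)]]) (use c p in auto)
    qed
  qed
  then show "globally_short E W p" using M unfolding globally_short_def by blast
  have "spare ?M (card W) ((p - 5) div 2) u v" if "u \<in> W" "v \<in> W" for u v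
    by (rule spare_mono[OF all[OF that]]) auto
  moreover have "spare ?M (card W) ((p - 1) div 2) x v" if "v \<in> W" for v
    using W[OF that]
  proof
    assume v: "v \<in> W\<^sub>1"
    show ?thesis by (rule spare_mono[OF from1[OF v]]) (use c p in auto)
  next
    assume v: "v \<in> W\<^sub>2"
    show ?thesis by (rule spare_mono[OF from2[OF v]]) (use c p in auto)
  qed
  moreover have "spare ?M (card W) (p div 2) v x" if "v \<in> W" for v
    using W[OF that]
  proof
    assume v: "v \<in> W\<^sub>1"
    show ?thesis by (rule spare_mono[OF to1[OF v]]) (use c p in auto)
  next
    assume v: "v \<in> W\<^sub>2"
    show ?thesis by (rule spare_mono[OF to2[OF v]]) (use c p in auto)
  qed
  ultimately show "rooted_short E W x p" using M unfolding rooted_short_def by blast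
qed

text \<open>This is the alternation along a chain. Passing from \<open>q\<close> to
  \<open>q + 1\<close> blocks, the bound away from the root rises exactly when \<open>q\<close> is
  even and the bound towards it exactly when \<open>q\<close> is odd, so one favoured direction in
  \<open>W\<^sub>1\<close> suffices.\<close>

lemma glued_off_root:
  assumes gl: "glued E W x W\<^sub>1 W\<^sub>2" and fin: "finite W" and bl: "two_edge_connected E W\<^sub>1"
    and s: "s \<in> W\<^sub>1" "s \<noteq> x"
    and "rooted_short E W\<^sub>2 x q"
    and p: "1 \<le> q" "2 < card W\<^sub>1" "2 * q < card W\<^sub>2" "p \<le> 1 + q"
  shows "rooted_short E W s p"
proof -
  note c = glued_card[OF gl fin]
  have x: "x \<in> W\<^sub>1" using gl unfolding glued_def by auto
  obtain M\<^sub>1 where M1: "orients E W\<^sub>1 M\<^sub>1" "strong W\<^sub>1 M\<^sub>1"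
    and sx: "if even q then spare M\<^sub>1 (card W\<^sub>1) 1 s x else spare M\<^sub>1 (card W\<^sub>1) 1 x s"
    using exists_orientation_spare[OF bl c(2) s(1) x s(2)]
      exists_orientation_spare[OF bl c(2) x s(1)] s(2) by (cases "even q") auto
  have all1: "spare M\<^sub>1 (card W\<^sub>1) 0 u v" if "u \<in> W\<^sub>1" "v \<in> W\<^sub>1" for u v
    using strong_spare M1 c(2) that by metis
  have sx1: "spare M\<^sub>1 (card W\<^sub>1) (if even q then 1 else 0) s x"
    and xs1: "spare M\<^sub>1 (card W\<^sub>1) (if even q then 0 else 1) x s"
    using sx all1 s x by (auto split: if_splits)
  obtain M\<^sub>2 where M2: "orients E W\<^sub>2 M\<^sub>2"
    and from2: "\<And>v. v \<in> W\<^sub>2 \<Longrightarrow> spare M\<^sub>2 (card W\<^sub>2) ((q - 1) div 2) x v"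
    and to2: "\<And>v. v \<in> W\<^sub>2 \<Longrightarrow> spare M\<^sub>2 (card W\<^sub>2) (q div 2) v x"
    and all2: "\<And>u v. u \<in> W\<^sub>2 \<Longrightarrow> v \<in> W\<^sub>2 \<Longrightarrow> spare M\<^sub>2 (card W\<^sub>2) ((q - 5) div 2) u v"
    using assms(6) unfolding rooted_short_def by auto
  let ?M = "M\<^sub>1 \<union> M\<^sub>2"
  have W: "v \<in> W\<^sub>1 \<or> v \<in> W\<^sub>2" if "v \<in> W" for v using that gl unfolding glued_def by auto
  have M: "orients E W ?M" using gl M1(1) M2 by (rule glued_orients)
  have "spare ?M (card W) ((p - 5) div 2) u v" if uv: "u \<in> W" "v \<in> W" for u v
  proof -
    consider "u \<in> W\<^sub>1" "v \<in> W\<^sub>1" | "u \<in> W\<^sub>2" "v \<in> W\<^sub>2" | "u \<in> W\<^sub>1" "v \<in> W\<^sub>2" | "u \<in> W\<^sub>2" "v \<in> W\<^sub>1"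
      using W uv by blast
    then show ?thesis
    proof cases
      case 1
      show ?thesis by (rule spare_mono[OF all1[OF 1]]) (use c p in auto)
    next
      case 2
      show ?thesis by (rule spare_mono[OF all2[OF 2]]) (use c p in auto)
    next
      case 3
      show ?thesis by (rule spare_concat[OF all1[OF 3(1) x] from2[OF 3(2)]]) (use c p in auto)
    next
      case 4
      show ?thesis by (rule spare_concat[OF to2[OF 4(1)] all1[OF x 4(2)]]) (use c p in auto)
    qed
  qed
  moreover have "spare ?M (card W) ((p - 1) div 2) s v" if "v \<in> W" for v
    using W[OF that]
  proof
    assume v: "v \<in> W\<^sub>1"
    show ?thesis by (rule spare_mono[OF all1[OF s(1) v]]) (use c p in auto)
  next
    assume v: "v \<in> W\<^sub>2"
    show ?thesis by (rule spare_concat[OF sx1 from2[OF v]]) (use c p in \<open>auto elim!: evenE oddE\<close>)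
  qed
  moreover have "spare ?M (card W) (p div 2) v s" if "v \<in> W" for v
    using W[OF that]
  proof
    assume v: "v \<in> W\<^sub>1"
    show ?thesis by (rule spare_mono[OF all1[OF v s(1)]]) (use c p in auto)
  next
    assume v: "v \<in> W\<^sub>2"
    show ?thesis by (rule spare_concat[OF to2[OF v] xs1]) (use c p in \<open>auto elim!: evenE oddE\<close>)
  qed
  ultimately show ?thesis using M unfolding rooted_short_def by blast
qed

text \<open>Both \<open>W\<^sub>2\<close> (at \<open>x\<close>) and \<open>W\<^sub>3\<close> (at
  \<open>y\<close>) hang on \<open>W\<^sub>0\<close>, which contains \<open>s\<close>. Walks between
  \<open>s\<close> and a vertex of one branch can avoid the other branch, whose size covers the
  deficit. Walks from branch to branch avoid neither and get only the sum of the three bounds, which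
  is why \<open>rooted_short\<close> asks for no more than \<open>(p - 5) div 2\<close>
  there.\<close>

lemma glued_twice:
  assumes gl: "glued E W x W\<^sub>1 W\<^sub>2" "glued E W\<^sub>1 y W\<^sub>0 W\<^sub>3" and fin: "finite W"
    and s: "s \<in> W\<^sub>0" and x: "x \<in> W\<^sub>0"
    and "globally_short E W\<^sub>0 p\<^sub>0" "rooted_short E W\<^sub>2 x p\<^sub>2" "rooted_short E W\<^sub>3 y p\<^sub>3"
    and p: "1 \<le> p\<^sub>0" "1 \<le> p\<^sub>2" "1 \<le> p\<^sub>3" "2 * p\<^sub>0 < card W\<^sub>0" "2 * p\<^sub>2 < card W\<^sub>2" "2 * p\<^sub>3 < card W\<^sub>3"
      "p \<le> p\<^sub>0 + p\<^sub>2 + p\<^sub>3"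
  shows "rooted_short E W s p"
proof -
  note c1 = glued_card[OF gl(1) fin]
  note c2 = glued_card[OF gl(2) c1(2)]
  have c: "card W + 2 = card W\<^sub>0 + card W\<^sub>2 + card W\<^sub>3" using c1(1) c2(1) by linarith
  have y: "y \<in> W\<^sub>0" using gl unfolding glued_def by auto
  obtain M\<^sub>0 where M0: "orients E W\<^sub>0 M\<^sub>0"
    and all0: "\<And>u v. u \<in> W\<^sub>0 \<Longrightarrow> v \<in> W\<^sub>0 \<Longrightarrow> spare M\<^sub>0 (card W\<^sub>0) (p\<^sub>0 div 2 - 1) u v"
    using assms(6) unfolding globally_short_def by auto
  obtain M\<^sub>2 where M2: "orients E W\<^sub>2 M\<^sub>2"
    and from2: "\<And>v. v \<in> W\<^sub>2 \<Longrightarrow> spare M\<^sub>2 (card W\<^sub>2) ((p\<^sub>2 - 1) div 2) x v"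
    and to2: "\<And>v. v \<in> W\<^sub>2 \<Longrightarrow> spare M\<^sub>2 (card W\<^sub>2) (p\<^sub>2 div 2) v x"
    and all2: "\<And>u v. u \<in> W\<^sub>2 \<Longrightarrow> v \<in> W\<^sub>2 \<Longrightarrow> spare M\<^sub>2 (card W\<^sub>2) ((p\<^sub>2 - 5) div 2) u v"
    using assms(7) unfolding rooted_short_def by auto
  obtain M\<^sub>3 where M3: "orients E W\<^sub>3 M\<^sub>3"
    and from3: "\<And>v. v \<in> W\<^sub>3 \<Longrightarrow> spare M\<^sub>3 (card W\<^sub>3) ((p\<^sub>3 - 1) div 2) y v"
    and to3: "\<And>v. v \<in> W\<^sub>3 \<Longrightarrow> spare M\<^sub>3 (card W\<^sub>3) (p\<^sub>3 div 2) v y"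
    and all3: "\<And>u v. u \<in> W\<^sub>3 \<Longrightarrow> v \<in> W\<^sub>3 \<Longrightarrow> spare M\<^sub>3 (card W\<^sub>3) ((p\<^sub>3 - 5) div 2) u v"
    using assms(8) unfolding rooted_short_def by auto
  let ?M = "M\<^sub>0 \<union> M\<^sub>3 \<union> M\<^sub>2"
  have W: "v \<in> W\<^sub>0 \<or> v \<in> W\<^sub>2 \<or> v \<in> W\<^sub>3" if "v \<in> W" for v using that gl unfolding glued_def by auto
  have M: "orients E W ?M" using gl(1) glued_orients[OF gl(2) M0 M3] M2 by (rule glued_orients)
  \<comment> \<open>The numbers of vertices of \<open>W\<^sub>0\<close> with one branch attached;
    comparing them with \<open>card W\<close> later credits the avoided branch.\<close>
  define n\<^sub>0\<^sub>2 where "n\<^sub>0\<^sub>2 = card W\<^sub>0 + card W\<^sub>2 - 1"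
  define n\<^sub>0\<^sub>3 where "n\<^sub>0\<^sub>3 = card W\<^sub>0 + card W\<^sub>3 - 1"
  have n: "n\<^sub>0\<^sub>2 + 1 = card W\<^sub>0 + card W\<^sub>2" "n\<^sub>0\<^sub>3 + 1 = card W\<^sub>0 + card W\<^sub>3"
    unfolding n\<^sub>0\<^sub>2_def n\<^sub>0\<^sub>3_def using p by auto
  have from02: "spare ?M n\<^sub>0\<^sub>2 ((p\<^sub>0 div 2 - 1) + (p\<^sub>2 - 1) div 2) u v" if "u \<in> W\<^sub>0" "v \<in> W\<^sub>2" for u v
    by (rule spare_concat[OF all0[OF that(1) x] from2[OF that(2)]]) (use n in auto)
  have to02: "spare ?M n\<^sub>0\<^sub>2 ((p\<^sub>0 div 2 - 1) + p\<^sub>2 div 2) u v" if "u \<in> W\<^sub>2" "v \<in> W\<^sub>0" for u v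
    by (rule spare_concat[OF to2[OF that(1)] all0[OF x that(2)]]) (use n in auto)
  have from03: "spare ?M n\<^sub>0\<^sub>3 ((p\<^sub>0 div 2 - 1) + (p\<^sub>3 - 1) div 2) u v" if "u \<in> W\<^sub>0" "v \<in> W\<^sub>3" for u v
    by (rule spare_concat[OF all0[OF that(1) y] from3[OF that(2)]]) (use n in auto)
  have to03: "spare ?M n\<^sub>0\<^sub>3 ((p\<^sub>0 div 2 - 1) + p\<^sub>3 div 2) u v" if "u \<in> W\<^sub>3" "v \<in> W\<^sub>0" for u v
    by (rule spare_concat[OF to3[OF that(1)] all0[OF y that(2)]]) (use n in auto)
  have "spare ?M (card W) ((p - 5) div 2) u v" if uv: "u \<in> W" "v \<in> W" for u v
  proof -
    consider "u \<in> W\<^sub>0" "v \<in> W\<^sub>0" | "u \<in> W\<^sub>2" "v \<in> W\<^sub>2" | "u \<in> W\<^sub>3" "v \<in> W\<^sub>3"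
      | "u \<in> W\<^sub>0" "v \<in> W\<^sub>2" | "u \<in> W\<^sub>2" "v \<in> W\<^sub>0" | "u \<in> W\<^sub>0" "v \<in> W\<^sub>3" | "u \<in> W\<^sub>3" "v \<in> W\<^sub>0"
      | "u \<in> W\<^sub>2" "v \<in> W\<^sub>3" | "u \<in> W\<^sub>3" "v \<in> W\<^sub>2"
      using W uv by blast
    then show ?thesis
    proof cases
      case 1
      show ?thesis by (rule spare_mono[OF all0[OF 1]]) (use c p in auto)
    next
      case 2
      show ?thesis by (rule spare_mono[OF all2[OF 2]]) (use c p in auto)
    next
      case 3
      show ?thesis by (rule spare_mono[OF all3[OF 3]]) (use c p in auto)
    next
      case 4
      show ?thesis by (rule spare_mono[OF from02[OF 4]]) (use c p n in auto)
    next
      case 5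
      show ?thesis by (rule spare_mono[OF to02[OF 5]]) (use c p n in auto)
    next
      case 6
      show ?thesis by (rule spare_mono[OF from03[OF 6]]) (use c p n in auto)
    next
      case 7
      show ?thesis by (rule spare_mono[OF to03[OF 7]]) (use c p n in auto)
    next
      case 8
      show ?thesis by (rule spare_concat[OF to02[OF 8(1) y] from3[OF 8(2)]]) (use c p n in auto)
    next
      case 9
      show ?thesis by (rule spare_concat[OF to03[OF 9(1) x] from2[OF 9(2)]]) (use c p n in auto)
    qed
  qed
  moreover have "spare ?M (card W) ((p - 1) div 2) s v" if "v \<in> W" for v
  proof -
    consider "v \<in> W\<^sub>0" | "v \<in> W\<^sub>2" | "v \<in> W\<^sub>3" using W \<open>v \<in> W\<close> by blast
    then show ?thesis
    proof cases
      case 1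
      show ?thesis by (rule spare_mono[OF all0[OF s 1]]) (use c p in auto)
    next
      case 2
      show ?thesis by (rule spare_mono[OF from02[OF s 2]]) (use c p n in auto)
    next
      case 3
      show ?thesis by (rule spare_mono[OF from03[OF s 3]]) (use c p n in auto)
    qed
  qed
  moreover have "spare ?M (card W) (p div 2) v s" if "v \<in> W" for v
  proof -
    consider "v \<in> W\<^sub>0" | "v \<in> W\<^sub>2" | "v \<in> W\<^sub>3" using W \<open>v \<in> W\<close> by blast
    then show ?thesis
    proof cases
      case 1
      show ?thesis by (rule spare_mono[OF all0[OF 1 s]]) (use c p in auto)
    next
      case 2
      show ?thesis by (rule spare_mono[OF to02[OF 2 s]]) (use c p n in auto)
    next
      case 3
      show ?thesis by (rule spare_mono[OF to03[OF 3 s]]) (use c p n in auto)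
    qed
  qed
  ultimately show ?thesis using M unfolding rooted_short_def by blast
qed

text \<open>For a root \<open>s\<close> that is not a cut vertex, a smallest part \<open>W\<^sub>1\<close> around \<open>s\<close> is split off. If it is
  separable, minimality forces its pieces away from \<open>s\<close> to be attached beside \<open>W\<^sub>2\<close>, and every
  walk from \<open>s\<close> avoids one of the two branches.\<close>

lemma two_edge_connected_short:
  assumes "two_edge_connected E W" "finite W" "W \<noteq> {}"
  shows "globally_short E W (card (block_sets E W)) \<and>
    (\<forall>s\<in>W. rooted_short E W s (card (block_sets E W)))"
  using assms
proof (induction "card W" arbitrary: W rule: less_induct)
  case less
  note bl = less.prems(1) and fin = less.prems(2)
  let ?p = "\<lambda>W. card (block_sets E W)"
  show ?case
  proof (cases "nonseparable E W")
    case True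
    \<comment> \<open>With one block all three bounds ask for zero spared vertices, so any strong
      orientation will do.\<close>
    obtain M where M: "orients E W M" "strong W M"
      using exists_strong_orientation[OF bl fin] by blast
    have "spare M (card W) 0 u v" if "u \<in> W" "v \<in> W" for u v
      using strong_spare M fin that by metis
    then show ?thesis
      using M card_block_sets_nonseparable[OF True]
      unfolding globally_short_def rooted_short_def by auto
  next
    case False
    have part: "two_edge_connected E U" "finite U" "card U < card W" "1 \<le> ?p U" "2 * ?p U < card U"
        "globally_short E U (?p U)" "\<And>s. s \<in> U \<Longrightarrow> rooted_short E U s (?p U)" "x \<in> U"
      if "glued E W x U U'" for x U U'
    proof -
      note c = glued_card[OF that fin]
      show b: "two_edge_connected E U" "finite U" "card U < card W"
        using that bl c glued_two_edge_connected by blast+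
      show "x \<in> U" using that unfolding glued_def by auto
      then show "1 \<le> ?p U" using block_sets_nonempty b by blast
      show "2 * ?p U < card U" using card_block_sets_less b c by blast
      show "globally_short E U (?p U)" "\<And>s. s \<in> U \<Longrightarrow> rooted_short E U s (?p U)"
        using less.hyps[of U] b \<open>x \<in> U\<close> by auto
    qed
    have root: "globally_short E W (?p W)" "rooted_short E W x (?p W)" if "glued E W x U U'" for x U U'
    proof -
      note p = part[OF that] part[OF glued_commute[OF that]]
      show "globally_short E W (?p W)" "rooted_short E W x (?p W)"
        by (rule glued_at_root[OF that fin]; use p card_block_sets_glued[OF that fin] in blast)+
    qed
    obtain x\<^sub>0 U\<^sub>0 U\<^sub>0' where gl0: "glued E W x\<^sub>0 U\<^sub>0 U\<^sub>0'"
      using exists_glued[OF two_edge_connected_strong[OF bl] less.prems(3) False] by blast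
    have "rooted_short E W s (?p W)" if s: "s \<in> W" for s
    proof (cases "\<exists>U U'. glued E W s U U'")
      case True
      then show ?thesis using root by blast
    next
      case nocut: False
      let ?P = "\<lambda>U. s \<in> U \<and> (\<exists>x U'. glued E W x U U')"
      have "\<exists>U. ?P U" using gl0 glued_commute[OF gl0] s unfolding glued_def by blast
      then obtain W\<^sub>1 where "?P W\<^sub>1" and min: "\<And>U. ?P U \<Longrightarrow> card W\<^sub>1 \<le> card U"
        using exists_least_iff[of "\<lambda>n. \<exists>U. ?P U \<and> card U = n"]
        by (metis not_le_imp_less)
      then obtain x W\<^sub>2 where gl: "glued E W x W\<^sub>1 W\<^sub>2" and s1: "s \<in> W\<^sub>1" by blast
      note p1 = part[OF gl] and p2 = part[OF glued_commute[OF gl]]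
      have sx: "s \<noteq> x" using gl nocut by blast
      show ?thesis
      proof (cases "nonseparable E W\<^sub>1")
        case True
        then have "?p W \<le> 1 + ?p W\<^sub>2"
          using card_block_sets_glued[OF gl fin] card_block_sets_nonseparable by metis
        then show ?thesis
          using glued_off_root[OF gl fin p1(1) s1 sx p2(7)] p1 p2 by fastforce
      next
        case False
        then obtain y H H' where gl1: "glued E W\<^sub>1 y H H'"
          using exists_glued[OF two_edge_connected_strong[OF p1(1)]] s1 by blast
        moreover have "s \<in> H \<or> s \<in> H'" using s1 gl1 unfolding glued_def by auto
        ultimately obtain W\<^sub>0 W\<^sub>3 where gl': "glued E W\<^sub>1 y W\<^sub>0 W\<^sub>3" and s0: "s \<in> W\<^sub>0"
          using glued_commute[OF gl1] by blast
        note c' = glued_card[OF gl' p1(2)]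
        have x0: "x \<in> W\<^sub>0"
        proof (rule ccontr)
          assume "x \<notin> W\<^sub>0"
          then have "x \<in> W\<^sub>3" using p1(8) gl' unfolding glued_def by auto
          then have "?P W\<^sub>0" using glued_assoc[OF gl gl'] s0 by blast
          then show False using min c' by (meson leD)
        qed
        \<comment> \<open>Since \<open>x\<close> lies in \<open>W\<^sub>0\<close>, the branch
          \<open>W\<^sub>3\<close> is a part of \<open>W\<close>, so \<open>part\<close> supplies
          its bounds. \<open>W\<^sub>0\<close> need not be such a part and takes the induction
          hypothesis directly.\<close>
        have gl3: "glued E W y W\<^sub>3 (W\<^sub>0 \<union> W\<^sub>2)"
          using glued_assoc[OF gl glued_commute[OF gl'] x0] .
        note p3 = part[OF gl3]
        have b0: "two_edge_connected E W\<^sub>0" "card W\<^sub>0 < card W"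
          using glued_two_edge_connected gl' p1(1) c' p1(3) by auto
        then have g0: "globally_short E W\<^sub>0 (?p W\<^sub>0)" using less.hyps[of W\<^sub>0] c'(2) s0 by blast
        have q0: "1 \<le> ?p W\<^sub>0" "2 * ?p W\<^sub>0 < card W\<^sub>0"
          using block_sets_nonempty card_block_sets_less b0 c' s0 by blast+
        have "?p W \<le> ?p W\<^sub>0 + ?p W\<^sub>2 + ?p W\<^sub>3"
          using card_block_sets_glued[OF gl fin] card_block_sets_glued[OF gl' p1(2)] by linarith
        then show ?thesis
          using glued_twice[OF gl gl' fin s0 x0 g0 p2(7)[OF p2(8)] p3(7)[OF p3(8)]] q0 p2 p3 by blast
      qed
    qed
    then show ?thesis using root(1)[OF gl0] by blast
  qed
qed

end

section \<open>Digraphs of the library\<close>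

context wf_digraph
begin

lemma strongly_connected_iff_strong:
  "strongly_connected G \<longleftrightarrow> verts G \<noteq> {} \<and> strong (verts G) (arcs_ends G)"
proof (intro iffI conjI; (elim conjE)?)
  assume sc: "strongly_connected G"
  show "verts G \<noteq> {}" using sc unfolding strongly_connected_def by simp
  show "strong (verts G) (arcs_ends G)"
    unfolding strong_def
  proof (intro allI impI, rule ccontr)
    fix S assume S: "S \<noteq> {} \<and> S \<subset> verts G" and no: "\<not> (\<exists>a\<in>S. \<exists>b\<in>verts G - S. a \<rightarrow> b)"
    obtain u v where uv: "u \<in> S" "v \<in> verts G" "v \<notin> S" using S by auto
    then have "u \<rightarrow>\<^sup>* v" using sc S unfolding strongly_connected_def by auto
    then have "v \<in> S"
    proof (induction rule: reachable_induct)
      case base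
      then show ?case using uv by simp
    next
      case (step x y)
      then show ?case using no adj_in_verts(2) by blast
    qed
    then show False using uv by simp
  qed
next
  assume ne: "verts G \<noteq> {}" and st: "strong (verts G) (arcs_ends G)"
  have "u \<rightarrow>\<^sup>* v" if "u \<in> verts G" "v \<in> verts G" for u v
  proof (rule ccontr)
    assume no: "\<not> u \<rightarrow>\<^sup>* v"
    let ?S = "{w \<in> verts G. u \<rightarrow>\<^sup>* w}"
    have "u \<in> ?S" "v \<notin> ?S" using that no by auto
    then have "?S \<noteq> {}" "?S \<subset> verts G" using that by auto
    then obtain a b where "a \<in> ?S" "b \<in> verts G - ?S" "a \<rightarrow> b"
      by (rule strongD[OF st])
    then show False using reachable_adj_trans by auto
  qed
  then show "strongly_connected G" using ne by auto
qed

lemma connected_iff_strong: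
  assumes "symmetric G"
  shows "connected G \<longleftrightarrow> verts G \<noteq> {} \<and> strong (verts G) (arcs_ends G)"
proof -
  have "connected G \<longleftrightarrow> strongly_connected G"
    unfolding connected_def strongly_connected_def
    using reachable_mk_symmetric_eq[OF assms] by simp
  then show ?thesis using strongly_connected_iff_strong by simp
qed

lemma arcs_ends_del_vert: "arcs_ends (del_vert v) = {(a, b) \<in> arcs_ends G. a \<noteq> v \<and> b \<noteq> v}"
  unfolding arcs_ends_conv del_vert_simps by auto

lemma symmetric_del_vert:
  assumes "symmetric G"
  shows "symmetric (del_vert v)"
  using assms unfolding symmetric_def arcs_ends_del_vert sym_def by blast

lemma not_cut_vertex_iff_strong:
  assumes "symmetric G" "strong (verts G) (arcs_ends G)"
  shows "\<not> cut_vertex G v \<longleftrightarrow> strong (verts G - {v}) (arcs_ends G)"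
proof -
  have *: "strong (verts G - {v}) (arcs_ends (del_vert v)) \<longleftrightarrow> strong (verts G - {v}) (arcs_ends G)"
    unfolding arcs_ends_del_vert by (rule strong_cong) auto
  have "connected (del_vert v) \<longleftrightarrow>
      verts G - {v} \<noteq> {} \<and> strong (verts G - {v}) (arcs_ends (del_vert v))"
    using wf_digraph.connected_iff_strong[OF wf_digraph_del_vert symmetric_del_vert[OF assms(1)]]
    by (simp add: verts_del_vert)
  moreover have "strong (verts G - {v}) (arcs_ends G)" if "v \<notin> verts G \<or> verts G - {v} = {}"
    using that assms(2) by (auto simp: strong_def)
  ultimately show ?thesis unfolding cut_vertex_def verts_del_vert using * by blast
qed

lemma relpow_imp_awalk:
  assumes "(u, v) \<in> arcs_ends G ^^ j" "u \<in> verts G"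
  shows "\<exists>p. awalk u p v \<and> awalk_cost (\<lambda>_. 1) p = real j"
  using assms(1)
proof (induction j arbitrary: v)
  case 0
  then show ?case using assms(2) by (auto simp: awalk_Nil_iff intro!: exI[of _ "[]"])
next
  case (Suc j)
  then obtain w where w: "(u, w) \<in> arcs_ends G ^^ j" "w \<rightarrow> v" by auto
  obtain p where p: "awalk u p w" "awalk_cost (\<lambda>_. 1) p = real j" using Suc.IH w by blast
  obtain e where e: "e \<in> arcs G" "tail G e = w" "head G e = v" using w(2) by (rule reachableE)
  have "awalk w [e] v" using e arc_implies_awalk by blast
  then have "awalk u (p @ [e]) v" using p awalk_appendI by blast
  then show ?case using p by (intro exI[of _ "p @ [e]"]) auto
qed

end

section \<open>Blocks, bridges and the oriented diameter\<close>

text \<open>Inducing on the vertices of a block keeps it connected and without cut vertices, so by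
  maximality a block is induced and determined by its vertex set. The inclusion bounds the number of
  blocks from above by the count used in the induction.\<close>

lemma (in graph) block_sets_blocks:
  "blocks G \<subseteq> (\<lambda>U. G \<restriction> U) ` block_sets (arcs_ends G) (verts G)"
proof
  let ?E = "arcs_ends G"
  let ?P = "\<lambda>H::('a, 'b) pre_digraph. symmetric H \<and> connected H \<and> (\<forall>v. \<not> cut_vertex H v)"
  have P_nonsep: "nonseparable ?E (verts H)" if sub: "subgraph H G" and P: "?P H" for H
  proof -
    interpret H: wf_digraph H using sub by blast
    have sub_E: "arcs_ends H \<subseteq> ?E" using sub by (rule arcs_ends_mono)
    have "verts H \<noteq> {}" "strong (verts H) (arcs_ends H)"
      using P H.connected_iff_strong by auto
    moreover from this have "strong (verts H - {v}) (arcs_ends H)" for v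
      using P H.not_cut_vertex_iff_strong by blast
    moreover have "strong V ?E" if "strong V (arcs_ends H)" for V
      using that by (rule strong_mono) (use sub_E in auto)
    ultimately show ?thesis unfolding nonseparable_def by simp
  qed
  have nonsep_P: "?P (G \<restriction> U)" if U: "U \<subseteq> verts G" and ns: "nonseparable ?E U" for U
  proof -
    interpret H: wf_digraph "G \<restriction> U" by (rule wellformed_induce_subgraph)
    have ends: "arcs_ends (G \<restriction> U) = ?E \<inter> U \<times> U"
      by (auto simp: arcs_ends_conv)
    have sy: "symmetric (G \<restriction> U)"
      using sym_arcs unfolding symmetric_def ends sym_def by blast
    have st: "strong V (arcs_ends (G \<restriction> U)) \<longleftrightarrow> strong V ?E" if "V \<subseteq> U" for V
      unfolding ends by (rule strong_cong) (use that in auto)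
    show ?thesis
      using sy H.connected_iff_strong[OF sy] H.not_cut_vertex_iff_strong[OF sy] ns st
      unfolding nonseparable_def by simp
  qed
  fix B assume "B \<in> blocks G"
  then have sub: "subgraph B G" and P: "?P B"
    and max: "\<And>H. subgraph B H \<Longrightarrow> subgraph H G \<Longrightarrow> ?P H \<Longrightarrow> H = B"
    unfolding blocks_def max_subgraph_def by blast+
  have vB: "verts B \<subseteq> verts G" using sub by blast
  \<comment> \<open>Used twice: for \<open>U = verts B\<close> it shows that \<open>B\<close> is
    induced, for larger \<open>U\<close> that \<open>verts B\<close> is maximal.\<close>
  have eq: "G \<restriction> U = B" if "verts B \<subseteq> U" "U \<subseteq> verts G" "nonseparable ?E U" for U
  proof (rule max)
    show "subgraph B (G \<restriction> U)"
      using sub that(1) wellformed_induce_subgraph unfolding subgraph_def compatible_def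
      by (auto dest: wf_digraph.head_in_verts wf_digraph.tail_in_verts)
    show "subgraph (G \<restriction> U) G" using that(2) by (rule subgraph_induce_subgraphI)
    show "?P (G \<restriction> U)" using nonsep_P that by blast
  qed
  have ns: "nonseparable ?E (verts B)" using P_nonsep sub P by blast
  have "verts B \<in> block_sets ?E (verts G)"
    unfolding block_sets_def
  proof (intro CollectI conjI allI impI vB ns)
    fix U assume "verts B \<subseteq> U \<and> U \<subseteq> verts G \<and> nonseparable ?E U"
    then have "G \<restriction> U = B" by (intro eq) auto
    then show "U = verts B" using induce_subgraph_verts[of G U] by simp
  qed
  moreover have "B = G \<restriction> verts B" using eq[OF order_refl vB ns] by (rule sym)
  ultimately show "B \<in> (\<lambda>U. G \<restriction> U) ` block_sets ?E (verts G)" by (rule rev_image_eqI)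
qed

text \<open>Connectedness gives one edge across the cut; deleting it leaves the graph connected,
  which gives a second.\<close>

lemma (in graph) bridgeless_two_edge_connected:
  assumes "bridgeless G"
  shows "two_edge_connected (arcs_ends G) (verts G)"
  unfolding two_edge_connected_def
proof (intro allI impI)
  fix S assume S: "S \<noteq> {} \<and> S \<subset> verts G"
  have "strong (verts G) (arcs_ends G)"
    using assms connected_iff_strong[OF sym_arcs] unfolding bridgeless_def by blast
  then obtain a b where ab: "a \<in> S" "b \<in> verts G - S" "a \<rightarrow> b"
    using S strongD[of "verts G" "arcs_ends G" S] by blast
  let ?H = "del_edge G a b"
  have H: "verts ?H = verts G" "arcs_ends ?H = arcs_ends G - {(a, b), (b, a)}"
    unfolding del_edge_def arcs_ends_def arc_to_ends_def by auto
  have wf: "wf_digraph ?H" unfolding del_edge_def by unfold_locales auto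
  have "symmetric ?H" using sym_arcs unfolding symmetric_def H sym_def by blast
  moreover have "connected ?H" using assms ab unfolding bridgeless_def bridge_def by blast
  ultimately have "strong (verts G) (arcs_ends ?H)"
    using wf_digraph.connected_iff_strong[OF wf] H by simp
  then obtain a' b' where "a' \<in> S" "b' \<in> verts G - S" "(a', b') \<in> arcs_ends ?H"
    using S strongD[of "verts G" "arcs_ends ?H" S] by blast
  then show "\<exists>a\<in>S. \<exists>b\<in>verts G - S. \<exists>a'\<in>S. \<exists>b'\<in>verts G - S. a \<rightarrow> b \<and> a' \<rightarrow> b' \<and> (a, b) \<noteq> (a', b')"
    using ab H by blast
qed

lemma (in graph) oriented_diameter_le:
  assumes M: "orients (arcs_ends G) (verts G) M" and ne: "verts G \<noteq> {}"
    and dist: "\<And>u v. u \<in> verts G \<Longrightarrow> v \<in> verts G \<Longrightarrow> \<exists>j. (u, v) \<in> M ^^ j \<and> j \<le> d"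
  shows "oriented_diameter G \<le> ereal (real d)"
proof -
  define D where "D = G\<lparr>arcs := {a \<in> arcs G. arc_to_ends G a \<in> M}\<rparr>"
  have M': "M \<subseteq> arcs_ends G" using M unfolding orients_def by auto
  have D: "verts D = verts G" "arcs_ends D = M"
    using M' unfolding D_def arcs_ends_def arc_to_ends_def by auto
  interpret D: wf_digraph D unfolding D_def by unfold_locales auto
  have "subgraph D G"
    unfolding subgraph_def compatible_def using D.wf_digraph wf_digraph by (auto simp: D_def)
  then have "orientation D G"
    using M D adj_in_verts unfolding orientation_def spanning_def orients_def by simp
  moreover have walk: "\<exists>p. D.awalk u p v \<and> D.awalk_cost (\<lambda>_. 1) p \<le> real d"
    if uv: "u \<in> verts G" "v \<in> verts G" for u v
  proof -
    obtain j where "(u, v) \<in> M ^^ j" "j \<le> d" using dist[OF uv] by blast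
    then show ?thesis using D.relpow_imp_awalk[of u v j] D uv by auto
  qed
  then have "strongly_connected D"
    using ne D D.reachable_awalk unfolding strongly_connected_def by blast
  ultimately have "oriented_diameter G \<le> diameter D"
    unfolding oriented_diameter_def by (intro INF_lower) auto
  also have "diameter D \<le> ereal (real d)"
    unfolding diameter_def
  proof (rule SUP_least, clarify)
    fix u v assume "u \<in> verts D" "v \<in> verts D"
    then obtain p where p: "D.awalk u p v" "D.awalk_cost (\<lambda>_. 1) p \<le> real d"
      using walk D(1) by metis
    have "D.\<mu> (\<lambda>_. 1) u v \<le> ereal (D.awalk_cost (\<lambda>_. 1) p)"
      using p(1) by (rule D.min_cost_le_walk_cost)
    then show "D.\<mu> (\<lambda>_. 1) u v \<le> ereal (real d)" using p(2) by (meson ereal_less_eq(3) order_trans)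
  qed
  finally show ?thesis .
qed

theorem theorem1:
  fixes G :: "('a,'b) pre_digraph" and n p :: nat
  assumes "graph G"
    and "bridgeless G"
    and "card (verts G) = n"
    and "card (blocks G) = p"
  shows "oriented_diameter G \<le> ereal (real n - real_of_int \<lfloor>real p / 2\<rfloor>)"
proof -
  interpret graph G by (rule assms(1))
  interpret edge_relation "arcs_ends G"
    using graph_symmetric adj_not_same by unfold_locales blast+
  let ?E = "arcs_ends G"
  define q where "q = card (block_sets ?E (verts G))"
  have ne: "verts G \<noteq> {}"
    using assms(2) unfolding bridgeless_def connected_def strongly_connected_def by simp
  have "p \<le> q"
    using surj_card_le[OF finite_block_sets block_sets_blocks] assms(4) unfolding q_def by simp
  obtain M where M: "orients ?E (verts G) M"
    and short: "\<And>u v. u \<in> verts G \<Longrightarrow> v \<in> verts G \<Longrightarrow> spare M n (q div 2 - 1) u v"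
    using two_edge_connected_short[OF bridgeless_two_edge_connected[OF assms(2)] _ ne]
    unfolding globally_short_def q_def assms(3) by auto
  have "\<exists>j. (u, v) \<in> M ^^ j \<and> j \<le> n - p div 2" if uv: "u \<in> verts G" "v \<in> verts G" for u v
  proof -
    obtain j where "(u, v) \<in> M ^^ j" "j + (q div 2 - 1) < n"
      using short[OF uv] unfolding spare_def by blast
    moreover have "p div 2 \<le> q div 2" using \<open>p \<le> q\<close> by (rule div_le_mono)
    ultimately show ?thesis by (intro exI[of _ j]) auto
  qed
  then have "oriented_diameter G \<le> ereal (real (n - p div 2))"
    by (rule oriented_diameter_le[OF M ne])
  \<comment> \<open>Needed to turn the truncated difference \<open>n - p div 2\<close> into the real
    one of the statement.\<close>
  moreover have "p div 2 \<le> n"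
  proof -
    obtain u where "u \<in> verts G" using ne by blast
    then have "q div 2 - 1 < n" using short[of u u] unfolding spare_def by auto
    then show ?thesis using div_le_mono[OF \<open>p \<le> q\<close>, of 2] by linarith
  qed
  moreover have "\<lfloor>real p / 2\<rfloor> = int (p div 2)"
    using floor_divide_of_nat_eq[of p 2] by simp
  ultimately show ?thesis by (simp add: of_nat_diff)
qed

end
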